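(* For every finite $n$, the modal logics $\mathrm{Log}(\omega^n,\preceq)$ and $\mathrm{Log}(\omega^n,\prec)$ have the finite model property.
   Context: $\omega=\{0,1,2,\dots\}$ is the set of natural numbers, and $\omega^n$ is the set of $n$-tuples $x=(x(i))_{i<n}$ of natural numbers. For $x,y\in\omega^n$: $x\preceq y$ iff $x(i)\le y(i)$ for all $i<n$; $x\prec y$ iff $x(i)<y(i)$ for all $i<n$ (so $\prec$ is the relation of the direct power of $(\omega,<)$, strict in every coordinate, not the strict part of $\preceq$). A (Kripke) frame is a pair $(W,R)$ with $R\subseteq W\times W$. For a frame $F$, $\mathrm{Log}(F)$ is the set of all propositional modal formulas (in the language with one modality $\Diamond$ and countably many propositional variables) valid in $F$ under the usual Kripke semantics. A logic (normal propositional modal logic) $L$ has the finite model property if it is complete with respect to a class of finite frames, i.e. $L$ is the set of all formulas valid in every frame of some class of finite frames (equivalently, $L$ is the logic of a class of finite modal algebras). *)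

theory Defs
  imports Main "HOL-Library.FuncSet"
begin

datatype fm = Var nat | Bot | Imp fm fm | Dia fm

type_synonym 'w frame = "'w set \<times> ('w \<times> 'w) set"

definition is_frame :: "'w frame \<Rightarrow> bool" where
  "is_frame F \<longleftrightarrow> snd F \<subseteq> fst F \<times> fst F"

fun sat :: "'w frame \<Rightarrow> (nat \<Rightarrow> 'w set) \<Rightarrow> 'w \<Rightarrow> fm \<Rightarrow> bool" where
  "sat F V w (Var p) \<longleftrightarrow> w \<in> V p"
| "sat F V w Bot \<longleftrightarrow> False"
| "sat F V w (Imp a b) \<longleftrightarrow> (sat F V w a \<longrightarrow> sat F V w b)"
| "sat F V w (Dia a) \<longleftrightarrow> (\<exists>v\<in>fst F. (w, v) \<in> snd F \<and> sat F V v a)"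

definition valid :: "'w frame \<Rightarrow> fm \<Rightarrow> bool" where
  "valid F a \<longleftrightarrow> (\<forall>V. (\<forall>p. V p \<subseteq> fst F) \<longrightarrow> (\<forall>w\<in>fst F. sat F V w a))"

definition Log :: "'w frame \<Rightarrow> fm set" where
  "Log F = {a. valid F a}"

text \<open>
  The class of finite frames is taken as a set of frames whose worlds are natural numbers.
  This loses nothing: by \<open>finite_frame_nat_copy\<close> below, every finite frame, over any type,
  has the same logic as a finite frame on natural numbers.
\<close>

definition finite_model_property :: "fm set \<Rightarrow> bool" where
  "finite_model_property L \<longleftrightarrow>
    (\<exists>C :: nat frame set. (\<forall>F\<in>C. is_frame F \<and> finite (fst F)) \<and> L = {a. \<forall>F\<in>C. valid F a})"

lemma sat_image:
  assumes "inj_on f (fst F)" "is_frame F" "w \<in> fst F" "\<And>p. V p \<subseteq> fst F"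
  shows "sat (f ` fst F, map_prod f f ` snd F) (\<lambda>p. f ` V p) (f w) a \<longleftrightarrow> sat F V w a"
  using assms(3)
proof (induction a arbitrary: w)
  case (Var p)
  then show ?case using assms(1,4) by (simp add: inj_on_image_mem_iff)
next
  case (Dia a)
  have "(f w, f v) \<in> map_prod f f ` snd F \<longleftrightarrow> (w, v) \<in> snd F" if "v \<in> fst F" for v
  proof
    assume "(f w, f v) \<in> map_prod f f ` snd F"
    then obtain x y where xy: "(x, y) \<in> snd F" "f w = f x" "f v = f y" by auto
    with assms(2) have "x \<in> fst F" "y \<in> fst F" by (auto simp: is_frame_def)
    with xy assms(1) Dia.prems that show "(w, v) \<in> snd F" by (metis inj_onD)
  qed force
  with Dia.IH show ?case by auto
qed auto

lemma finite_frame_nat_copy: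
  fixes F :: "'w frame"
  assumes "is_frame F" "finite (fst F)"
  shows "\<exists>G :: nat frame. is_frame G \<and> finite (fst G) \<and> Log G = Log F"
proof -
  obtain f :: "'w \<Rightarrow> nat" where f: "inj_on f (fst F)"
    using finite_imp_inj_to_nat_seg[OF assms(2)] by blast
  define G where "G = (f ` fst F, map_prod f f ` snd F)"
  have "valid G a \<longleftrightarrow> valid F a" for a
  proof
    assume G: "valid G a"
    show "valid F a"
      unfolding valid_def
    proof (intro allI impI ballI)
      fix V :: "nat \<Rightarrow> 'w set" and w assume V: "\<forall>p. V p \<subseteq> fst F" and w: "w \<in> fst F"
      have "sat G (\<lambda>p. f ` V p) (f w) a"
        using G V w unfolding valid_def G_def by (metis fst_conv image_eqI image_mono)
      then show "sat F V w a"
        using sat_image[OF f assms(1) w] V unfolding G_def by blast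
    qed
  next
    assume F: "valid F a"
    show "valid G a"
      unfolding valid_def
    proof (intro allI impI ballI)
      fix V :: "nat \<Rightarrow> nat set" and u assume V: "\<forall>p. V p \<subseteq> fst G" and u: "u \<in> fst G"
      define V' where "V' p = {x \<in> fst F. f x \<in> V p}" for p
      have V': "V' p \<subseteq> fst F" for p by (auto simp: V'_def)
      have eq: "V = (\<lambda>p. f ` V' p)"
        using V by (fastforce simp: V'_def G_def)
      obtain w where w: "w \<in> fst F" "u = f w" using u by (auto simp: G_def)
      have "sat F V' w a" using F V' w by (auto simp: valid_def)
      then show "sat G V u a"
        using sat_image[of f F w V' a] f assms(1) w V' unfolding G_def eq by blast
    qed
  qed
  moreover have "is_frame G" "finite (fst G)"
    using assms by (auto simp: G_def is_frame_def)
  ultimately show ?thesis unfolding Log_def by blast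
qed

text \<open>Tuples are extensional functions, so distinct elements of \<open>omega_pow n\<close> differ at some \<open>i < n\<close>.\<close>

definition omega_pow :: "nat \<Rightarrow> (nat \<Rightarrow> nat) set" where
  "omega_pow n = {..<n} \<rightarrow>\<^sub>E UNIV"

definition le_pow :: "nat \<Rightarrow> ((nat \<Rightarrow> nat) \<times> (nat \<Rightarrow> nat)) set" where
  "le_pow n = {(x, y). x \<in> omega_pow n \<and> y \<in> omega_pow n \<and> (\<forall>i<n. x i \<le> y i)}"

definition less_pow :: "nat \<Rightarrow> ((nat \<Rightarrow> nat) \<times> (nat \<Rightarrow> nat)) set" where
  "less_pow n = {(x, y). x \<in> omega_pow n \<and> y \<in> omega_pow n \<and> (\<forall>i<n. x i < y i)}"

end

theory Submission imports Defs begin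

text \<open>
  Let \<open>W = \<omega>\<^sup>n\<close> with either relation, and suppose that a formula is refuted in \<open>W\<close> under some valuation.
  The valuation colours \<open>W\<close> by the finitely many sets of variables of that formula.  It is enough
  to refine this colouring to a finite partition that is \<^emph>\<open>tuned\<close>: if some point of a class \<open>A\<close> sees
  the class \<open>B\<close>, then every point of \<open>A\<close> sees \<open>B\<close>.  For a tuned partition the quotient map is a
  p-morphism onto a finite frame; this frame validates the logic of \<open>W\<close> and still refutes the formula
  (\<open>finite_model_property_if_tuned_refinements\<close>).

  The tuned refinement records, besides the colour of a point \<open>x\<close>, the set \<open>I\<close> of its small
  coordinates and the exact values of \<open>x\<close> on \<open>I\<close>.  Smallness has to be such that, once the values on
  \<open>I\<close> are fixed and the others are known to be large, every colour that still occurs occurs with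
  the other coordinates arbitrarily large.  Then whether \<open>x\<close> sees a class with small coordinates \<open>J\<close>
  and values \<open>b\<close> on \<open>J\<close> depends only on how \<open>x\<close> compares with \<open>b\<close> on \<open>J\<close>.  When it sees the class at
  all, \<open>J \<subseteq> I\<close>, so the comparison is decided by the class of \<open>x\<close>.

  No single threshold separates small from large: for a larger threshold \<open>K\<close> there are more tuples of
  small values, and for each of them the other coordinates may have to be larger than \<open>K\<close> before all
  the remaining colours recur.  But a threshold that works for all tuples of values below \<open>K\<close> exists
  (\<open>recurrence_threshold\<close>), so there is an increasing sequence \<open>K 0, K 1, \<dots>\<close>
  in which each term is adequate for the previous one.  By counting coordinates,
  every \<open>x\<close> has a level \<open>m \<le> n\<close> such that each coordinate of \<open>x\<close> is either below \<open>K m\<close> or at least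
  \<open>K (Suc m)\<close> (\<open>small_coords_below_level\<close>); the former are the small ones.  With this choice
  the quotient map is tuned (\<open>tuned_small_part\<close>).
\<close>

section \<open>Finite quotients by tuned maps\<close>

fun vars :: "fm \<Rightarrow> nat set" where
  "vars (Var p) = {p}"
| "vars Bot = {}"
| "vars (Imp a b) = vars a \<union> vars b"
| "vars (Dia a) = vars a"

lemma finite_vars: "finite (vars a)"
  by (induction a) auto

lemma sat_cong_vars:
  assumes "\<And>p w. p \<in> vars a \<Longrightarrow> w \<in> fst F \<Longrightarrow> w \<in> V p \<longleftrightarrow> w \<in> V' p" and "w \<in> fst F"
  shows "sat F V w a \<longleftrightarrow> sat F V' w a"
  using assms by (induction a arbitrary: w) auto

definition image_frame :: "('w \<Rightarrow> 'k) \<Rightarrow> 'w frame \<Rightarrow> 'k frame" where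
  "image_frame f F = (f ` fst F, map_prod f f ` snd F)"

definition tuned :: "('w \<Rightarrow> 'k) \<Rightarrow> 'w frame \<Rightarrow> bool" where
  "tuned f F \<longleftrightarrow> (\<forall>(x, y)\<in>snd F. \<forall>x'\<in>fst F. f x' = f x \<longrightarrow> (\<exists>y'. (x', y') \<in> snd F \<and> f y' = f y))"

text \<open>
  Truth is preserved because \<open>f\<close> is a p-morphism: the forth condition is the definition of the image
  frame, and the back condition is tunedness.
\<close>

lemma sat_image_frame:
  assumes F: "is_frame F" and f: "tuned f F" and "w \<in> fst F"
  shows "sat (image_frame f F) U (f w) a \<longleftrightarrow> sat F (\<lambda>p. {x \<in> fst F. f x \<in> U p}) w a"
  using assms(3)
proof (induction a arbitrary: w)
  case (Dia a)
  let ?V = "\<lambda>p. {x \<in> fst F. f x \<in> U p}"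
  show ?case
  proof
    assume "sat (image_frame f F) U (f w) (Dia a)"
    then obtain x y where xy: "(x, y) \<in> snd F" "f w = f x" "sat (image_frame f F) U (f y) a"
      by (auto simp: image_frame_def)
    with f Dia.prems obtain y' where y': "(w, y') \<in> snd F" "f y' = f y"
      unfolding tuned_def by fastforce
    then have "y' \<in> fst F" using F by (auto simp: is_frame_def)
    moreover from this have "sat F ?V y' a" using Dia.IH xy(3) y'(2) by metis
    ultimately show "sat F ?V w (Dia a)" using y'(1) by auto
  next
    assume "sat F ?V w (Dia a)"
    then obtain y where y: "y \<in> fst F" "(w, y) \<in> snd F" "sat F ?V y a" by auto
    then have "sat (image_frame f F) U (f y) a" using Dia.IH by blast
    moreover have "(f w, f y) \<in> snd (image_frame f F)" "f y \<in> fst (image_frame f F)"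
      using y by (force simp: image_frame_def)+
    ultimately show "sat (image_frame f F) U (f w) (Dia a)" by auto
  qed
qed (auto simp: image_frame_def)

lemma valid_image_frame:
  assumes "is_frame F" "tuned f F" "valid F a"
  shows "valid (image_frame f F) a"
  unfolding valid_def
proof (intro allI impI ballI)
  fix U u assume "u \<in> fst (image_frame f F)"
  then obtain w where w: "w \<in> fst F" "u = f w" by (auto simp: image_frame_def)
  have "sat F (\<lambda>p. {x \<in> fst F. f x \<in> U p}) w a"
    using assms(3) w(1) by (auto simp: valid_def)
  then show "sat (image_frame f F) U u a"
    using sat_image_frame[OF assms(1,2) w(1)] w(2) by simp
qed

lemma finite_model_property_if_tuned_refinements:
  fixes F :: "'w frame"
  assumes F: "is_frame F"
    and refine: "\<And>col :: 'w \<Rightarrow> nat set. finite (col ` fst F) \<Longrightarrow>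
      \<exists>f :: 'w \<Rightarrow> 'k. finite (f ` fst F) \<and> tuned f F \<and>
        (\<forall>x\<in>fst F. \<forall>y\<in>fst F. f x = f y \<longrightarrow> col x = col y)"
  shows "finite_model_property (Log F)"
proof -
  define C :: "nat frame set" where
    "C = {G. is_frame G \<and> finite (fst G) \<and> Log F \<subseteq> Log G}"
  have "\<exists>G\<in>C. \<not> valid G a" if "\<not> valid F a" for a
  proof -
    from that obtain V w where V: "\<forall>p. V p \<subseteq> fst F" and w: "w \<in> fst F" and nsat: "\<not> sat F V w a"
      by (auto simp: valid_def)
    define col where "col x = {p \<in> vars a. x \<in> V p}" for x
    have "finite (col ` fst F)"
      by (rule finite_subset[of _ "Pow (vars a)"]) (auto simp: col_def finite_vars)
    then obtain f :: "'w \<Rightarrow> 'k" where fin: "finite (f ` fst F)" and f: "tuned f F"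
      and col: "\<forall>x\<in>fst F. \<forall>y\<in>fst F. f x = f y \<longrightarrow> col x = col y"
      using refine by blast
    define G where "G = image_frame f F"
    have G: "is_frame G" "finite (fst G)"
      using F fin by (auto simp: G_def image_frame_def is_frame_def)
    have sub: "Log F \<subseteq> Log G"
      using valid_image_frame[OF F f] by (auto simp: Log_def G_def)
    define U where "U p = f ` V p" for p
    have "x \<in> V p \<longleftrightarrow> x \<in> {x \<in> fst F. f x \<in> U p}" if "p \<in> vars a" "x \<in> fst F" for p x
    proof
      assume "x \<in> {x \<in> fst F. f x \<in> U p}"
      then obtain y where y: "y \<in> V p" "f x = f y" by (auto simp: U_def)
      then have "col x = col y" using col V that(2) by blast
      then show "x \<in> V p" using y(1) that(1) by (auto simp: col_def)
    qed (use that in \<open>auto simp: U_def\<close>)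
    from sat_cong_vars[OF this w] have "\<not> sat G U (f w) a"
      using nsat sat_image_frame[OF F f w] by (simp add: G_def)
    moreover have "\<forall>p. U p \<subseteq> fst G" "f w \<in> fst G"
      using V w by (auto simp: U_def G_def image_frame_def)
    ultimately have "a \<notin> Log G" by (auto simp: Log_def valid_def)
    moreover obtain H :: "nat frame" where H: "is_frame H" "finite (fst H)" "Log H = Log G"
      using finite_frame_nat_copy[OF G] by blast
    ultimately have "H \<in> C" "a \<notin> Log H" using sub by (auto simp: C_def)
    then show ?thesis by (auto simp: Log_def)
  qed
  then have "Log F = {a. \<forall>G\<in>C. valid G a}"
    by (auto simp: C_def Log_def)
  then show ?thesis
    unfolding finite_model_property_def by (intro exI[of _ C]) (auto simp: C_def)
qed

section \<open>Recurring colours\<close>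

text \<open>
  The colour of \<open>x\<close> recurs when the values of \<open>x\<close> on \<open>I\<close> are kept and all others go to infinity.
\<close>

definition recurrent :: "nat \<Rightarrow> ((nat \<Rightarrow> nat) \<Rightarrow> 'c) \<Rightarrow> nat set \<Rightarrow> (nat \<Rightarrow> nat) \<Rightarrow> bool" where
  "recurrent n col I x \<longleftrightarrow>
    (\<forall>N. \<exists>v\<in>omega_pow n. (\<forall>i\<in>I. v i = x i) \<and> (\<forall>i\<in>{..<n} - I. N \<le> v i) \<and> col v = col x)"

text \<open>
  Only finitely many triples of a set \<open>I\<close>, a tuple of values below \<open>K\<close> on \<open>I\<close> and a colour exist.  A
  triple that does not recur has a bound beyond which it does not occur at all, and
  the threshold is the largest of these bounds.
\<close>

lemma recurrence_threshold:
  fixes col :: "(nat \<Rightarrow> nat) \<Rightarrow> 'c"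
  assumes fin: "finite (col ` omega_pow n)"
  shows "\<exists>K'\<ge>K. \<forall>I\<subseteq>{..<n}. \<forall>x\<in>omega_pow n.
    (\<forall>i\<in>I. x i < K) \<longrightarrow> (\<forall>i\<in>{..<n} - I. K' \<le> x i) \<longrightarrow> recurrent n col I x"
proof -
  define key where "key = (\<lambda>(I, x). (I, restrict x I, col x))"
  define S where "S = {(I, x). I \<subseteq> {..<n} \<and> x \<in> omega_pow n \<and> (\<forall>i\<in>I. x i < K)}"
  have "key ` S \<subseteq> (SIGMA I:Pow {..<n}. (I \<rightarrow>\<^sub>E {..<K}) \<times> col ` omega_pow n)"
    by (auto simp: key_def S_def)
  moreover have "finite (SIGMA I:Pow {..<n}. (I \<rightarrow>\<^sub>E {..<K}) \<times> col ` omega_pow n)"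
    using fin by (intro finite_SigmaI finite_PiE finite_cartesian_product)
      (auto intro: finite_subset[of _ "{..<n}"])
  ultimately have finT: "finite (key ` S)" by (rule finite_subset)
  have "\<exists>N. \<forall>I x. (I, x) \<in> S \<longrightarrow> key (I, x) = t \<longrightarrow> (\<forall>i\<in>{..<n} - I. N \<le> x i) \<longrightarrow> recurrent n col I x" for t
  proof (rule ccontr)
    assume none: "\<nexists>N. \<forall>I x. (I, x) \<in> S \<longrightarrow> key (I, x) = t \<longrightarrow> (\<forall>i\<in>{..<n} - I. N \<le> x i) \<longrightarrow> recurrent n col I x"
    \<comment> \<open>If no bound works, then points with the triple \<open>t\<close> occur beyond every \<open>N\<close>, so \<open>t\<close> recurs.\<close>
    have "\<exists>I x. (I, x) \<in> S \<and> key (I, x) = t \<and> (\<forall>i\<in>{..<n} - I. N \<le> x i) \<and> \<not> recurrent n col I x" for N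
      using none by blast
    then obtain I x where Ix: "\<And>N. (I N, x N) \<in> S" "\<And>N. key (I N, x N) = t"
        "\<And>N. \<forall>i\<in>{..<n} - I N. N \<le> x N i" "\<And>N. \<not> recurrent n col (I N) (x N)"
      by metis
    have I: "I N = I 0" and r: "restrict (x N) (I N) = restrict (x 0) (I 0)" and c: "col (x N) = col (x 0)"
      for N
      using Ix(2)[of N] Ix(2)[of 0] by (auto simp: key_def)
    have "\<forall>i\<in>I 0. x N i = x 0 i" for N
      using r[of N] unfolding I[of N] by (metis restrict_apply')
    moreover have "x N \<in> omega_pow n" for N
      using Ix(1)[of N] by (simp add: S_def)
    moreover have "\<forall>i\<in>{..<n} - I 0. N \<le> x N i" for N
      using Ix(3)[of N] unfolding I[of N] .
    ultimately have "recurrent n col (I 0) (x 0)"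
      unfolding recurrent_def using c by blast
    with Ix(4) show False by blast
  qed
  then have "\<forall>t. \<exists>N. \<forall>I x. (I, x) \<in> S \<longrightarrow> key (I, x) = t \<longrightarrow>
      (\<forall>i\<in>{..<n} - I. N \<le> x i) \<longrightarrow> recurrent n col I x"
    by (rule allI)
  from choice[OF this] obtain N where
    N: "\<forall>t I x. (I, x) \<in> S \<longrightarrow> key (I, x) = t \<longrightarrow>
      (\<forall>i\<in>{..<n} - I. N t \<le> x i) \<longrightarrow> recurrent n col I x"
    by (rule exE)
  define K' where "K' = Max (insert K (N ` key ` S))"
  have le: "N (key (I, x)) \<le> K'" if "(I, x) \<in> S" for I x
    using finT that by (auto simp: K'_def intro!: Max_ge)
  have "K \<le> K'" using finT by (auto simp: K'_def)
  moreover have "recurrent n col I x"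
    if "I \<subseteq> {..<n}" "x \<in> omega_pow n" "\<forall>i\<in>I. x i < K" "\<forall>i\<in>{..<n} - I. K' \<le> x i" for I x
  proof -
    have S: "(I, x) \<in> S" using that by (auto simp: S_def)
    have "\<forall>i\<in>{..<n} - I. N (key (I, x)) \<le> x i"
      using that(4) le[OF S] order_trans by blast
    with N S show ?thesis by blast
  qed
  ultimately show ?thesis by blast
qed

lemma recurrence_thresholds:
  fixes col :: "(nat \<Rightarrow> nat) \<Rightarrow> 'c"
  assumes "finite (col ` omega_pow n)"
  obtains K :: "nat \<Rightarrow> nat" where "mono K"
    and "\<And>m I x. \<lbrakk>I \<subseteq> {..<n}; x \<in> omega_pow n; \<forall>i\<in>I. x i < K m; \<forall>i\<in>{..<n} - I. K (Suc m) \<le> x i\<rbrakk>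
      \<Longrightarrow> recurrent n col I x"
proof -
  obtain next_K where next_K: "\<And>k. next_K k \<ge> k"
    "\<And>k I x. \<lbrakk>I \<subseteq> {..<n}; x \<in> omega_pow n; \<forall>i\<in>I. x i < k; \<forall>i\<in>{..<n} - I. next_K k \<le> x i\<rbrakk>
      \<Longrightarrow> recurrent n col I x"
    using recurrence_threshold[OF assms] by metis
  define K where "K m = (next_K ^^ m) 0" for m
  have "K m \<le> K (Suc m)" for m using next_K(1) by (simp add: K_def)
  then have "mono K" by (simp add: mono_iff_le_Suc)
  then show thesis
    using that[of K] next_K(2) by (simp add: K_def)
qed

section \<open>Small coordinates\<close>

definition coords_below :: "nat \<Rightarrow> nat \<Rightarrow> (nat \<Rightarrow> nat) \<Rightarrow> nat set" where
  "coords_below n k x = {i. i < n \<and> x i < k}"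

lemma finite_coords_below [simp]: "finite (coords_below n k x)"
  by (simp add: coords_below_def)

text \<open>
  Any \<open>m\<close> for which no coordinate lies in the interval from \<open>K m\<close> to \<open>K (Suc m)\<close> would separate the
  small coordinates from the others.  Selecting \<open>m\<close> by the number of coordinates below \<open>K (Suc m)\<close>
  produces such a gap and moreover makes the level antitone: raising coordinates can
  only lower that number.
\<close>

definition level :: "nat \<Rightarrow> (nat \<Rightarrow> nat) \<Rightarrow> (nat \<Rightarrow> nat) \<Rightarrow> nat" where
  "level n K x = (LEAST m. card (coords_below n (K (Suc m)) x) \<le> m)"

definition small_coords :: "nat \<Rightarrow> (nat \<Rightarrow> nat) \<Rightarrow> (nat \<Rightarrow> nat) \<Rightarrow> nat set" where
  "small_coords n K x = coords_below n (K (Suc (level n K x))) x"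

lemma card_coords_below_le: "card (coords_below n k x) \<le> n"
  using card_mono[of "{..<n}" "coords_below n k x"] by (auto simp: coords_below_def)

lemma card_small_coords_le: "card (small_coords n K x) \<le> level n K x"
  unfolding small_coords_def level_def by (rule LeastI) (rule card_coords_below_le)

lemma level_le: "card (coords_below n (K (Suc m)) x) \<le> m \<Longrightarrow> level n K x \<le> m"
  unfolding level_def by (rule Least_le)

text \<open>
  Minimality of the level \<open>m\<close> leaves at least \<open>m\<close> coordinates below \<open>K m\<close>, whereas at most \<open>m\<close> are
  below \<open>K (Suc m)\<close>; hence they are the same coordinates, and the interval between is empty.
\<close>

lemma small_coords_below_level:
  assumes "mono K" and i: "i \<in> small_coords n K x"
  shows "x i < K (level n K x)"
proof (cases "level n K x")
  case 0
  with card_small_coords_le[of n K x] i show ?thesis by (simp add: small_coords_def)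
next
  case (Suc l)
  let ?B = "coords_below n (K (level n K x)) x"
  have "?B \<subseteq> small_coords n K x"
    using monoD[OF assms(1), of "level n K x" "Suc (level n K x)"]
    by (auto simp: small_coords_def coords_below_def)
  moreover have "card (small_coords n K x) \<le> card ?B"
  proof -
    have "\<not> card ?B \<le> l" using level_le[of n K l x] Suc by auto
    then show ?thesis using card_small_coords_le[of n K x] Suc by linarith
  qed
  ultimately have "?B = small_coords n K x"
    by (intro card_seteq) (auto simp: small_coords_def)
  with i show ?thesis by (auto simp: coords_below_def)
qed

text \<open>
  The level of \<open>y\<close> is at most that of \<open>x\<close>, so its small coordinates are below the threshold of \<open>x\<close> as
  well.  Thus a point sees only classes whose small coordinates are among its own.
\<close>

lemma small_coords_antimono:
  assumes "mono K" and le: "\<forall>i<n. x i \<le> y i"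
  shows "small_coords n K y \<subseteq> small_coords n K x"
proof -
  have sub: "coords_below n (K (Suc (level n K x))) y \<subseteq> small_coords n K x"
    using le by (auto simp: small_coords_def coords_below_def intro: le_less_trans)
  then have "card (coords_below n (K (Suc (level n K x))) y) \<le> level n K x"
    using card_mono[OF _ sub] card_small_coords_le[of n K x] by (simp add: small_coords_def)
  then have "level n K y \<le> level n K x" by (rule level_le)
  then have "K (Suc (level n K y)) \<le> K (Suc (level n K x))" using monoD[OF assms(1)] by simp
  then have "small_coords n K y \<subseteq> coords_below n (K (Suc (level n K x))) y"
    by (auto simp: small_coords_def coords_below_def)
  with sub show ?thesis by blast
qed

lemma small_coords_cong:
  assumes "mono K" and eq: "\<forall>i\<in>small_coords n K y. v i = y i"
    and ge: "\<forall>i\<in>{..<n} - small_coords n K y. K (Suc (level n K y)) \<le> v i"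
  shows "small_coords n K v = small_coords n K y"
proof -
  have same: "coords_below n (K (Suc m)) v = coords_below n (K (Suc m)) y" if "m \<le> level n K y" for m
  proof -
    have K: "K (Suc m) \<le> K (Suc (level n K y))" using monoD[OF assms(1)] that by simp
    have "v i < K (Suc m) \<longleftrightarrow> y i < K (Suc m)" if "i < n" for i
    proof (cases "i \<in> small_coords n K y")
      case False
      with that have "K (Suc (level n K y)) \<le> y i" by (auto simp: small_coords_def coords_below_def)
      moreover have "K (Suc (level n K y)) \<le> v i" using ge False that by blast
      ultimately show ?thesis using K by linarith
    qed (use eq in simp)
    then show ?thesis by (auto simp: coords_below_def)
  qed
  have "card (coords_below n (K (Suc (level n K y))) v) \<le> level n K y"
    using same[of "level n K y"] card_small_coords_le[of n K y] by (simp add: small_coords_def)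
  then have le: "level n K v \<le> level n K y" by (rule level_le)
  have "card (coords_below n (K (Suc (level n K v))) y) \<le> level n K v"
    using same[OF le] card_small_coords_le[of n K v] by (simp add: small_coords_def)
  then have "level n K y \<le> level n K v" by (rule level_le)
  with le same[of "level n K y"] show ?thesis by (simp add: small_coords_def)
qed

section \<open>The tuned refinement\<close>

definition small_part ::
    "nat \<Rightarrow> (nat \<Rightarrow> nat) \<Rightarrow> ((nat \<Rightarrow> nat) \<Rightarrow> 'c) \<Rightarrow> (nat \<Rightarrow> nat) \<Rightarrow> nat set \<times> (nat \<Rightarrow> nat) \<times> 'c" where
  "small_part n K col x = (small_coords n K x, restrict x (small_coords n K x), col x)"

lemma finite_small_part:
  assumes "mono K" and "finite (col ` omega_pow n)"
  shows "finite (small_part n K col ` omega_pow n)"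
proof (rule finite_subset)
  have "x i < K (Suc n)" if "i \<in> small_coords n K x" for x i
  proof -
    have "level n K x \<le> n" by (intro level_le card_coords_below_le)
    then have "K (level n K x) \<le> K (Suc n)" using monoD[OF assms(1)] by simp
    with small_coords_below_level[OF assms(1) that] show ?thesis by simp
  qed
  moreover have "small_coords n K x \<subseteq> {..<n}" for x
    by (auto simp: small_coords_def coords_below_def)
  ultimately show "small_part n K col ` omega_pow n \<subseteq>
      (SIGMA I:Pow {..<n}. (I \<rightarrow>\<^sub>E {..<K (Suc n)}) \<times> col ` omega_pow n)"
    unfolding small_part_def by fastforce
  show "finite (SIGMA I:Pow {..<n}. (I \<rightarrow>\<^sub>E {..<K (Suc n)}) \<times> col ` omega_pow n)"
    using assms(2) by (intro finite_SigmaI finite_PiE finite_cartesian_product)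
      (auto intro: finite_subset[of _ "{..<n}"])
qed

text \<open>
  Let \<open>x\<close> see \<open>y\<close>, and let \<open>x'\<close> be in the class of \<open>x\<close>.  On the small coordinates of \<open>y\<close>, which are
  small for \<open>x\<close> too, \<open>x'\<close> agrees with \<open>x\<close>; so any point that agrees with \<open>y\<close> there and
  is large elsewhere is seen by \<open>x'\<close>.  Recurrence puts such a point in the class of \<open>y\<close>.  The argument
  needs of \<open>r\<close> only that it lies between \<open><\<close> and \<open>\<le>\<close>, hence covers both orders.
\<close>

lemma tuned_small_part:
  fixes r :: "nat \<Rightarrow> nat \<Rightarrow> bool" and col :: "(nat \<Rightarrow> nat) \<Rightarrow> 'c"
  assumes "mono K"
    and recur: "\<And>m I x. \<lbrakk>I \<subseteq> {..<n}; x \<in> omega_pow n; \<forall>i\<in>I. x i < K m; \<forall>i\<in>{..<n} - I. K (Suc m) \<le> x i\<rbrakk>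
      \<Longrightarrow> recurrent n col I x"
    and r_le: "\<And>a b. r a b \<Longrightarrow> a \<le> b" and less_r: "\<And>a b. a < b \<Longrightarrow> r a b"
  shows "tuned (small_part n K col)
    (omega_pow n, {(x, y). x \<in> omega_pow n \<and> y \<in> omega_pow n \<and> (\<forall>i<n. r (x i) (y i))})"
proof -
  have "\<exists>v. v \<in> omega_pow n \<and> (\<forall>i<n. r (x' i) (v i)) \<and> small_part n K col v = small_part n K col y"
    if y: "y \<in> omega_pow n" and xy: "\<forall>i<n. r (x i) (y i)"
      and x': "small_part n K col x' = small_part n K col x" for x y x'
  proof -
    let ?J = "small_coords n K y"
    have "?J \<subseteq> small_coords n K x"
      using small_coords_antimono[OF assms(1)] xy r_le by blast
    then have agree: "x' i = x i" if "i \<in> ?J" for i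
      using x' that unfolding small_part_def by (metis Pair_inject restrict_apply' subsetD)
    have "recurrent n col ?J y"
    proof (rule recur[where m = "level n K y"])
      show "\<forall>i\<in>?J. y i < K (level n K y)"
        using small_coords_below_level[OF assms(1)] by blast
    qed (use y in \<open>auto simp: small_coords_def coords_below_def\<close>)
    \<comment> \<open>The bound makes \<open>v\<close> exceed every coordinate of \<open>x'\<close> and keeps it above the threshold of \<open>y\<close>.\<close>
    then obtain v where v: "v \<in> omega_pow n" "\<forall>i\<in>?J. v i = y i" "col v = col y"
      "\<forall>i\<in>{..<n} - ?J. K (Suc (level n K y)) + Suc (\<Sum>i<n. x' i) \<le> v i"
      unfolding recurrent_def by meson
    have "r (x' i) (v i)" if "i < n" for i
    proof (cases "i \<in> ?J")
      case True
      then show ?thesis using agree v(2) xy that by simp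
    next
      case False
      have "x' i \<le> (\<Sum>i<n. x' i)" using that by (intro member_le_sum) auto
      moreover have "K (Suc (level n K y)) + Suc (\<Sum>i<n. x' i) \<le> v i"
        using v(4) False that by blast
      ultimately have "x' i < v i" by linarith
      then show ?thesis by (rule less_r)
    qed
    moreover have "small_coords n K v = ?J"
      using v(2,4) add_leD1 by (intro small_coords_cong[OF assms(1)]) blast+
    then have "small_part n K col v = small_part n K col y"
      using v(2,3) by (auto simp: small_part_def restrict_def)
    ultimately show ?thesis using v(1) by blast
  qed
  then show ?thesis unfolding tuned_def by fastforce
qed

lemma finite_model_property_omega_pow:
  fixes r :: "nat \<Rightarrow> nat \<Rightarrow> bool"
  assumes "\<And>a b. r a b \<Longrightarrow> a \<le> b" and "\<And>a b. a < b \<Longrightarrow> r a b"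
  shows "finite_model_property
    (Log (omega_pow n, {(x, y). x \<in> omega_pow n \<and> y \<in> omega_pow n \<and> (\<forall>i<n. r (x i) (y i))}))"
    (is "finite_model_property (Log ?F)")
proof (rule finite_model_property_if_tuned_refinements)
  show "is_frame ?F" by (auto simp: is_frame_def)
next
  fix col :: "(nat \<Rightarrow> nat) \<Rightarrow> nat set" assume "finite (col ` fst ?F)"
  then have fin: "finite (col ` omega_pow n)" by simp
  then obtain K where K: "mono K"
    "\<And>m I x. \<lbrakk>I \<subseteq> {..<n}; x \<in> omega_pow n; \<forall>i\<in>I. x i < K m; \<forall>i\<in>{..<n} - I. K (Suc m) \<le> x i\<rbrakk>
      \<Longrightarrow> recurrent n col I x"
    using recurrence_thresholds by blast
  have "tuned (small_part n K col) ?F"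
    using K assms by (rule tuned_small_part)
  moreover have "finite (small_part n K col ` fst ?F)"
    using finite_small_part[OF K(1) fin] by simp
  moreover have "small_part n K col x = small_part n K col y \<Longrightarrow> col x = col y" for x y
    by (simp add: small_part_def)
  ultimately show "\<exists>f :: (nat \<Rightarrow> nat) \<Rightarrow> nat set \<times> (nat \<Rightarrow> nat) \<times> nat set.
      finite (f ` fst ?F) \<and> tuned f ?F \<and> (\<forall>x\<in>fst ?F. \<forall>y\<in>fst ?F. f x = f y \<longrightarrow> col x = col y)"
    by blast
qed

theorem corollary1:
  fixes n :: nat
  shows "finite_model_property (Log (omega_pow n, le_pow n)) \<and>
         finite_model_property (Log (omega_pow n, less_pow n))"
  unfolding le_pow_def less_pow_def by (intro conjI finite_model_property_omega_pow) auto

end
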